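(* Let $k$ be a field and let $\Sigma$ be a finite oriented signed graph on vertex set $V=[n]$ (multiple edges, loops and half-edges allowed), with bidirection $\tau$. Let $S_\Sigma=k[U_e : e \text{ an edge of }\Sigma]$ and let $\phi\colon S_\Sigma\to k[t_1^{\pm1},\dots,t_n^{\pm1}]$ be the $k$-algebra map with $\phi(U_e)=t_i^{\tau(i,e)}t_j^{\tau(j,e)}$ if $e$ has ends $i,j$ (with $i=j$ allowed for a loop, so a loop with equal incidence signs $\delta,\delta$ maps to $t_i^{2\delta}$ and a loop with opposite incidence signs maps to $1$), and $\phi(U_e)=t_i^{\tau(i,e)}$ if $e$ is a half-edge at $i$. Then the toric ideal $I_\Sigma=\ker\phi$ is generated by the cycle binomials $$U(C)=\prod_{e\in W(C)}U_{\pi(e)}-\prod_{e\in A(C)}U_{\pi(e)},$$ where $C$ runs over the cycles of the signed covering $\widetilde\Sigma$ that are not fixed orientation-wise by the involution $\iota$.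
   Context: An oriented signed graph is a graph $\Gamma$ with a sign $\sigma(e)\in\{\pm\}$ on each edge and a bidirection $\tau$ assigning a sign $\tau(v,e)\in\{\pm1\}$ to each incidence of a vertex $v$ with an edge $e$, compatible in the sense $\sigma(e)=-\tau(v,e)\tau(w,e)$ for an edge with ends $v,w$ (a half-edge has a single incidence). The signed covering $\widetilde\Sigma$ is the directed (multi)graph on vertex set $\{\pm1,\dots,\pm n\}\cup\{0\}$ obtained as follows: an edge $e$ of $\Sigma$ with ends $i\neq j$ and incidence signs $\delta=\tau(i,e)$, $\epsilon=\tau(j,e)$ gives the two directed edges $\delta i\to-\epsilon j$ and $\epsilon j\to -\delta i$; a loop at $i$ with both incidence signs $\delta$ gives the single directed edge $\delta i\to-\delta i$; a loop at $i$ with opposite incidence signs gives a self-loop at $i$ and a self-loop at $-i$; a half-edge at $i$ with incidence sign $\delta$ gives the directed edges $\delta i\to 0$ and $0\to-\delta i$. For an edge $e$ of $\widetilde\Sigma$, $\pi(e)$ denotes the edge of $\Sigma$ it comes from. The involution $\iota$ of $\widetilde\Sigma$ sends vertex $v$ to $-v$ (fixing $0$) and sends each directed edge $x\to y$ to the directed edge $-y\to-x$ coming from the same edge of $\Sigma$ (so $\iota$ swaps the two edges arising from one edge of $\Sigma$). A cycle $C$ of $\widetilde\Sigma$ is a cycle of the underlying undirected multigraph (a self-loop is a cycle of length one); choosing a direction of traversal, $W(C)$ is the set of edges of $C$ traversed along their direction and $A(C)$ the set traversed against it. $\iota(C)$ is given the traversal induced by applying $\iota$ to the traversal of $C$. $C$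 is fixed orientation-wise by $\iota$ if $\iota(C)=C$ as sets of edges and $W(\iota(C))=W(C)$ (hence $A(\iota(C))=A(C)$). *)

theory Defs
  imports
    "HOL-Library.Poly_Mapping"
    "HOL-Algebra.Ideal"
    "HOL-Algebra.RingHom"
    "Graph_Theory.Arc_Walk"
begin

section \<open>Oriented signed graphs\<close>

text \<open>
  An edge has an ordered pair of ends (possibly equal, for a loop) or, if it is a half-edge, a
  single end. The order carries no meaning: it only names the two incidences of the edge, so that
  the two incidences of a loop can be told apart. The incidence of a half-edge is \<open>First\<close>.
\<close>

datatype side = First | Second

primrec other :: "side \<Rightarrow> side" where
  "other First = Second"
| "other Second = First"

datatype edge_ends = Half nat | Ends nat nat

record 'e osgraph =
  edges :: "'e set"
  ends :: "'e \<Rightarrow> edge_ends"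
  esign :: "'e \<Rightarrow> int"
  bidir :: "'e \<Rightarrow> side \<Rightarrow> int"

text \<open>
  Finite oriented signed graph on the vertex set \<open>{1..n}\<close>. Signs are the integers \<open>1\<close> and \<open>-1\<close>;
  the compatibility of signs and bidirection concerns only edges with two ends.
\<close>

definition oriented_signed_graph :: "nat \<Rightarrow> 'e osgraph \<Rightarrow> bool" where
  "oriented_signed_graph n \<Sigma> \<longleftrightarrow>
     finite (edges \<Sigma>) \<and>
     (\<forall>e\<in>edges \<Sigma>. esign \<Sigma> e \<in> {1, -1} \<and>
        (case ends \<Sigma> e of
           Half i \<Rightarrow> i \<in> {1..n} \<and> bidir \<Sigma> e First \<in> {1, -1}
         | Ends i j \<Rightarrow> i \<in> {1..n} \<and> j \<in> {1..n} \<and>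
             bidir \<Sigma> e First \<in> {1, -1} \<and> bidir \<Sigma> e Second \<in> {1, -1} \<and>
             esign \<Sigma> e = - (bidir \<Sigma> e First * bidir \<Sigma> e Second)))"

section \<open>The signed covering\<close>

text \<open>
  The signed end of an incidence is \<open>\<tau>(i, e) i\<close>; for a half-edge the missing second end counts as
  the vertex \<open>0\<close>. The arc \<open>(e, s)\<close> of the covering leaves the signed end \<open>s\<close> of \<open>e\<close> and enters the
  negative of the other signed end. Thus \<open>i, j\<close> with signs \<open>\<delta>, \<epsilon>\<close> yields \<open>\<delta> i \<rightarrow> - \<epsilon> j\<close> and
  \<open>\<epsilon> j \<rightarrow> - \<delta> i\<close>, a half-edge yields \<open>\<delta> i \<rightarrow> 0\<close> and \<open>0 \<rightarrow> - \<delta> i\<close>, and a loop with opposite signs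
  yields a self-loop at \<open>i\<close> and one at \<open>- i\<close>. For a loop with two equal signs both arcs would be
  \<open>\<delta> i \<rightarrow> - \<delta> i\<close>, and only \<open>(e, First)\<close> is kept.
\<close>

definition signed_end :: "'e osgraph \<Rightarrow> 'e \<Rightarrow> side \<Rightarrow> int" where
  "signed_end \<Sigma> e s =
     (case ends \<Sigma> e of
        Half i \<Rightarrow> (case s of First \<Rightarrow> bidir \<Sigma> e First * int i | Second \<Rightarrow> 0)
      | Ends i j \<Rightarrow> (case s of First \<Rightarrow> bidir \<Sigma> e First * int i | Second \<Rightarrow> bidir \<Sigma> e Second * int j))"

definition equal_sign_loop :: "'e osgraph \<Rightarrow> 'e \<Rightarrow> bool" where
  "equal_sign_loop \<Sigma> e \<longleftrightarrow>
     (\<exists>i. ends \<Sigma> e = Ends i i) \<and> bidir \<Sigma> e First = bidir \<Sigma> e Second"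

definition signed_covering :: "nat \<Rightarrow> 'e osgraph \<Rightarrow> (int, 'e \<times> side) pre_digraph" where
  "signed_covering n \<Sigma> =
     \<lparr> verts = {- int n..int n},
       arcs = {(e, s). e \<in> edges \<Sigma> \<and> (equal_sign_loop \<Sigma> e \<longrightarrow> s = First)},
       tail = (\<lambda>(e, s). signed_end \<Sigma> e s),
       head = (\<lambda>(e, s). - signed_end \<Sigma> e (other s)) \<rparr>"

text \<open>The projection \<open>\<pi>\<close>, and the involution \<open>\<iota>\<close> on arcs; on vertices, \<open>\<iota>\<close> is negation.\<close>

definition cov_proj :: "'e \<times> side \<Rightarrow> 'e" where
  "cov_proj = fst"

definition iota :: "'e osgraph \<Rightarrow> 'e \<times> side \<Rightarrow> 'e \<times> side" where
  "iota \<Sigma> = (\<lambda>(e, s). if equal_sign_loop \<Sigma> e then (e, s) else (e, other s))"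

lemma wf_signed_covering:
  assumes "oriented_signed_graph n \<Sigma>"
  shows "wf_digraph (signed_covering n \<Sigma>)"
proof -
  have *: "- int n \<le> signed_end \<Sigma> e s \<and> signed_end \<Sigma> e s \<le> int n" if "e \<in> edges \<Sigma>" for e s
    using assms that
    by (fastforce simp: oriented_signed_graph_def signed_end_def split: edge_ends.splits side.splits)
  show ?thesis
    by unfold_locales (use * in \<open>fastforce simp: signed_covering_def\<close>)+
qed

lemma iota_in_arcs:
  "a \<in> arcs (signed_covering n \<Sigma>) \<Longrightarrow> iota \<Sigma> a \<in> arcs (signed_covering n \<Sigma>)"
  by (auto simp: signed_covering_def iota_def split: if_splits)

lemma other_other [simp]: "other (other s) = s"
  by (cases s) auto

lemma iota_iota: "iota \<Sigma> (iota \<Sigma> a) = a"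
  by (cases a) (auto simp: iota_def)

lemma signed_end_equal_sign_loop:
  "equal_sign_loop \<Sigma> e \<Longrightarrow> signed_end \<Sigma> e s = signed_end \<Sigma> e s'"
  by (cases s; cases s') (auto simp: equal_sign_loop_def signed_end_def)

lemma tail_iota: "tail (signed_covering n \<Sigma>) (iota \<Sigma> a) = - head (signed_covering n \<Sigma>) a"
  using signed_end_equal_sign_loop[of \<Sigma> "fst a" "snd a" "other (snd a)"]
  by (cases a) (auto simp: signed_covering_def iota_def)

lemma head_iota: "head (signed_covering n \<Sigma>) (iota \<Sigma> a) = - tail (signed_covering n \<Sigma>) a"
  using signed_end_equal_sign_loop[of \<Sigma> "fst a" "snd a" "other (snd a)"]
  by (cases a) (auto simp: signed_covering_def iota_def)

section \<open>Cycles of the underlying undirected multigraph\<close>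

text \<open>
  A cycle with a direction of traversal is a list of steps \<open>(a, d)\<close>, where \<open>d\<close> tells whether the
  arc \<open>a\<close> is traversed along its direction. Steps are the arcs of the digraph \<open>steps D\<close>. A list of
  steps is an undirected cycle if it is a cycle of \<open>steps D\<close> that uses no arc of \<open>D\<close> twice; the
  last condition only excludes traversing one arc back and forth.
\<close>

definition steps :: "('v, 'a) pre_digraph \<Rightarrow> ('v, 'a \<times> bool) pre_digraph" where
  "steps D =
     \<lparr> verts = verts D,
       arcs = arcs D \<times> UNIV,
       tail = (\<lambda>(a, d). if d then tail D a else head D a),
       head = (\<lambda>(a, d). if d then head D a else tail D a) \<rparr>"

definition undirected_cycle :: "('v, 'a) pre_digraph \<Rightarrow> ('a \<times> bool) list \<Rightarrow> bool" where
  "undirected_cycle D C \<longleftrightarrow> pre_digraph.cycle (steps D) C \<and> distinct (map fst C)"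

definition along :: "('a \<times> bool) list \<Rightarrow> 'a set" where
  "along C = {a. (a, True) \<in> set C}"

definition against :: "('a \<times> bool) list \<Rightarrow> 'a set" where
  "against C = {a. (a, False) \<in> set C}"

text \<open>
  Traversing \<open>a : x \<rightarrow> y\<close> from \<open>x\<close> to \<open>y\<close> becomes, under \<open>\<iota>\<close>, traversing \<open>\<iota> a : - y \<rightarrow> - x\<close> from
  \<open>- x\<close> to \<open>- y\<close>, that is, against its direction.
\<close>

definition iota_cycle :: "'e osgraph \<Rightarrow> (('e \<times> side) \<times> bool) list \<Rightarrow> (('e \<times> side) \<times> bool) list" where
  "iota_cycle \<Sigma> = map (\<lambda>(a, d). (iota \<Sigma> a, \<not> d))"

definition fixed_orientationwise :: "'e osgraph \<Rightarrow> (('e \<times> side) \<times> bool) list \<Rightarrow> bool" where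
  "fixed_orientationwise \<Sigma> C \<longleftrightarrow>
     fst ` set (iota_cycle \<Sigma> C) = fst ` set C \<and> along (iota_cycle \<Sigma> C) = along C"

lemma tail_step_iota:
  "tail (steps (signed_covering n \<Sigma>)) (iota \<Sigma> a, \<not> d) = - tail (steps (signed_covering n \<Sigma>)) (a, d)"
  by (simp add: steps_def tail_iota head_iota)

lemma head_step_iota:
  "head (steps (signed_covering n \<Sigma>)) (iota \<Sigma> a, \<not> d) = - head (steps (signed_covering n \<Sigma>)) (a, d)"
  by (simp add: steps_def tail_iota head_iota)

lemma undirected_cycle_iota_cycle:
  assumes "undirected_cycle (signed_covering n \<Sigma>) C"
  shows "undirected_cycle (signed_covering n \<Sigma>) (iota_cycle \<Sigma> C)"
proof -
  let ?D = "steps (signed_covering n \<Sigma>)"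
  have verts: "pre_digraph.awalk_verts ?D (- u) (iota_cycle \<Sigma> p)
      = map uminus (pre_digraph.awalk_verts ?D u p)" for u p
    by (induction p arbitrary: u)
      (auto simp: iota_cycle_def pre_digraph.awalk_verts.simps tail_step_iota head_step_iota)
  have cas: "pre_digraph.cas ?D u p v \<Longrightarrow> pre_digraph.cas ?D (- u) (iota_cycle \<Sigma> p) (- v)" for u v p
    by (induction p arbitrary: u)
      (auto simp: iota_cycle_def pre_digraph.cas.simps tail_step_iota head_step_iota)
  obtain u where u: "pre_digraph.awalk ?D u C u" "distinct (tl (pre_digraph.awalk_verts ?D u C))"
    "C \<noteq> []" and d: "distinct (map fst C)"
    using assms by (auto simp: undirected_cycle_def pre_digraph.cycle_def)
  have "set (iota_cycle \<Sigma> C) \<subseteq> arcs ?D"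
    using u(1) iota_in_arcs[of _ n \<Sigma>]
    by (fastforce simp: iota_cycle_def pre_digraph.awalk_def steps_def)
  moreover have "- u \<in> verts ?D"
    using u(1) by (auto simp: pre_digraph.awalk_def steps_def signed_covering_def)
  ultimately have "pre_digraph.awalk ?D (- u) (iota_cycle \<Sigma> C) (- u)"
    using u(1) cas by (auto simp: pre_digraph.awalk_def)
  moreover have "distinct (tl (pre_digraph.awalk_verts ?D (- u) (iota_cycle \<Sigma> C)))"
    using u(2) by (simp add: verts map_tl[symmetric] distinct_map)
  moreover have "map fst (iota_cycle \<Sigma> C) = map (iota \<Sigma>) (map fst C)"
    by (auto simp: iota_cycle_def)
  moreover have "inj (iota \<Sigma>)"
    by (metis injI iota_iota)
  ultimately show ?thesis
    using u(3) d inj_on_subset[OF \<open>inj (iota \<Sigma>)\<close>]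
    by (auto simp: undirected_cycle_def pre_digraph.cycle_def distinct_map iota_cycle_def
        simp del: map_map)
qed

section \<open>The toric ideal\<close>

text \<open>
  For \<open>'m = nat\<close> this is the polynomial ring \<open>k[x : x \<in> X]\<close> and for \<open>'m = int\<close> the Laurent
  polynomial ring: a (Laurent) polynomial is a finitely supported function on exponent vectors, and
  the multiplication of \<open>poly_mapping\<close> is convolution.
\<close>

definition poly_ring :: "'x set \<Rightarrow> (('x \<Rightarrow>\<^sub>0 'm::comm_monoid_add) \<Rightarrow>\<^sub>0 'k::comm_ring_1) ring" where
  "poly_ring X =
     \<lparr> carrier = {p. \<forall>m\<in>Poly_Mapping.keys p. Poly_Mapping.keys m \<subseteq> X},
       mult = (*), one = 1, zero = 0, add = (+) \<rparr>"

definition const :: "'k \<Rightarrow> ('x \<Rightarrow>\<^sub>0 'm::comm_monoid_add) \<Rightarrow>\<^sub>0 'k::comm_ring_1" where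
  "const c = Poly_Mapping.single 0 c"

definition edge_var :: "'e \<Rightarrow> ('e \<Rightarrow>\<^sub>0 nat) \<Rightarrow>\<^sub>0 'k::comm_ring_1" where
  "edge_var e = Poly_Mapping.single (Poly_Mapping.single e 1) 1"

definition tpow :: "nat \<Rightarrow> int \<Rightarrow> (nat \<Rightarrow>\<^sub>0 int) \<Rightarrow>\<^sub>0 'k::comm_ring_1" where
  "tpow i z = Poly_Mapping.single (Poly_Mapping.single i z) 1"

definition edge_image :: "'e osgraph \<Rightarrow> 'e \<Rightarrow> (nat \<Rightarrow>\<^sub>0 int) \<Rightarrow>\<^sub>0 'k::comm_ring_1" where
  "edge_image \<Sigma> e =
     (case ends \<Sigma> e of
        Half i \<Rightarrow> tpow i (bidir \<Sigma> e First)
      | Ends i j \<Rightarrow> tpow i (bidir \<Sigma> e First) * tpow j (bidir \<Sigma> e Second))"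

definition mon_image :: "'e osgraph \<Rightarrow> ('e \<Rightarrow>\<^sub>0 nat) \<Rightarrow> (nat \<Rightarrow>\<^sub>0 int) \<Rightarrow>\<^sub>0 'k::comm_ring_1" where
  "mon_image \<Sigma> m = (\<Prod>e\<in>Poly_Mapping.keys m. edge_image \<Sigma> e ^ Poly_Mapping.lookup m e)"

definition phi :: "'e osgraph \<Rightarrow> (('e \<Rightarrow>\<^sub>0 nat) \<Rightarrow>\<^sub>0 'k::comm_ring_1) \<Rightarrow> (nat \<Rightarrow>\<^sub>0 int) \<Rightarrow>\<^sub>0 'k" where
  "phi \<Sigma> p = (\<Sum>m\<in>Poly_Mapping.keys p. const (Poly_Mapping.lookup p m) * mon_image \<Sigma> m)"

abbreviation edge_ring :: "'e osgraph \<Rightarrow> (('e \<Rightarrow>\<^sub>0 nat) \<Rightarrow>\<^sub>0 'k::field) ring" where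
  "edge_ring \<Sigma> \<equiv> poly_ring (edges \<Sigma>)"

abbreviation laurent_ring :: "nat \<Rightarrow> ((nat \<Rightarrow>\<^sub>0 int) \<Rightarrow>\<^sub>0 'k::field) ring" where
  "laurent_ring n \<equiv> poly_ring {1..n}"

definition toric_ideal :: "nat \<Rightarrow> 'e osgraph \<Rightarrow> (('e \<Rightarrow>\<^sub>0 nat) \<Rightarrow>\<^sub>0 'k::field) set" where
  "toric_ideal n \<Sigma> = a_kernel (edge_ring \<Sigma>) (laurent_ring n) (phi \<Sigma>)"

definition cycle_binomial :: "(('e \<times> side) \<times> bool) list \<Rightarrow> ('e \<Rightarrow>\<^sub>0 nat) \<Rightarrow>\<^sub>0 'k::comm_ring_1" where
  "cycle_binomial C =
     (\<Prod>a\<in>along C. edge_var (cov_proj a)) - (\<Prod>a\<in>against C. edge_var (cov_proj a))"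

subsection \<open>The map is a homomorphism of algebras\<close>

lemma cring_poly_ring:
  "cring (poly_ring X :: (('x \<Rightarrow>\<^sub>0 'm::comm_monoid_add) \<Rightarrow>\<^sub>0 'k::comm_ring_1) ring)"
proof (rule cringI)
  let ?R = "poly_ring X :: (('x \<Rightarrow>\<^sub>0 'm) \<Rightarrow>\<^sub>0 'k) ring"
  show "abelian_group ?R"
  proof (rule abelian_groupI)
    fix x y :: "('x \<Rightarrow>\<^sub>0 'm) \<Rightarrow>\<^sub>0 'k"
    assume "x \<in> carrier ?R" "y \<in> carrier ?R"
    then show "x \<oplus>\<^bsub>?R\<^esub> y \<in> carrier ?R"
      using keys_add[of x y] by (fastforce simp: poly_ring_def)
  next
    fix x assume "x \<in> carrier ?R"
    then have "- x \<in> carrier ?R" by (auto simp: poly_ring_def in_keys_iff)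
    then show "\<exists>y\<in>carrier ?R. y \<oplus>\<^bsub>?R\<^esub> x = \<zero>\<^bsub>?R\<^esub>"
      by (intro bexI[of _ "- x"]) (auto simp: poly_ring_def)
  qed (auto simp: poly_ring_def algebra_simps)
  show "comm_monoid ?R"
  proof (rule comm_monoidI)
    fix x y :: "('x \<Rightarrow>\<^sub>0 'm) \<Rightarrow>\<^sub>0 'k"
    assume xy: "x \<in> carrier ?R" "y \<in> carrier ?R"
    have "Poly_Mapping.keys m \<subseteq> X" if m: "m \<in> Poly_Mapping.keys (x * y)" for m
    proof -
      obtain a b where "m = a + b" "a \<in> Poly_Mapping.keys x" "b \<in> Poly_Mapping.keys y"
        using keys_mult[of x y] m by blast
      then show ?thesis using xy keys_add[of a b] by (fastforce simp: poly_ring_def)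
    qed
    then show "x \<otimes>\<^bsub>?R\<^esub> y \<in> carrier ?R" by (auto simp: poly_ring_def)
  qed (auto simp: poly_ring_def algebra_simps)
qed (auto simp: poly_ring_def algebra_simps)

lemma const_zero: "const 0 = 0"
  and const_one: "const 1 = 1"
  and const_add: "const (a + b) = const a + const b"
  and const_mult: "const (a * b) = const a * const b"
  by (simp_all add: const_def single_add mult_single)

lemma mon_image_add: "mon_image \<Sigma> (m + m') = mon_image \<Sigma> m * mon_image \<Sigma> m'"
proof -
  let ?K = "Poly_Mapping.keys m \<union> Poly_Mapping.keys m'"
  have *: "mon_image \<Sigma> q = (\<Prod>e\<in>?K. edge_image \<Sigma> e ^ Poly_Mapping.lookup q e)"
    if "Poly_Mapping.keys q \<subseteq> ?K" for q
    unfolding mon_image_def using that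
    by (intro prod.mono_neutral_left) (auto simp: in_keys_iff)
  show ?thesis
    using keys_add[of m m'] by (simp add: * lookup_add power_add prod.distrib)
qed

lemma phi_zero: "phi \<Sigma> 0 = 0"
  by (simp add: phi_def)

lemma phi_add: "phi \<Sigma> (p + q) = phi \<Sigma> p + phi \<Sigma> q"
  unfolding phi_def
  by (rule setsum_keys_plus_distrib) (simp_all add: const_zero const_add algebra_simps)

lemma phi_sum: "phi \<Sigma> (sum f A) = (\<Sum>x\<in>A. phi \<Sigma> (f x))"
  by (induction A rule: infinite_finite_induct) (simp_all add: phi_zero phi_add)

lemma phi_single: "phi \<Sigma> (Poly_Mapping.single m c) = const c * mon_image \<Sigma> m"
  by (simp add: phi_def const_zero)

lemma poly_mapping_sum_single: "p = (\<Sum>m\<in>Poly_Mapping.keys p. Poly_Mapping.single m (Poly_Mapping.lookup p m))"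
  by (rule poly_mapping_eqI)
    (auto simp: lookup_sum lookup_single when_def in_keys_iff)

lemma phi_mult: "phi \<Sigma> (p * q) = phi \<Sigma> p * phi \<Sigma> q"
proof -
  have "p * q = (\<Sum>m\<in>Poly_Mapping.keys p. \<Sum>m'\<in>Poly_Mapping.keys q.
      Poly_Mapping.single (m + m') (Poly_Mapping.lookup p m * Poly_Mapping.lookup q m'))"
    by (subst poly_mapping_sum_single[of p], subst poly_mapping_sum_single[of q])
      (simp add: sum_product mult_single)
  then have "phi \<Sigma> (p * q) = (\<Sum>m\<in>Poly_Mapping.keys p. \<Sum>m'\<in>Poly_Mapping.keys q.
      (const (Poly_Mapping.lookup p m) * mon_image \<Sigma> m)
      * (const (Poly_Mapping.lookup q m') * mon_image \<Sigma> m'))"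
    by (simp add: phi_sum phi_single mon_image_add const_mult mult_ac)
  then show ?thesis
    by (simp add: phi_def sum_product)
qed

lemma phi_const: "phi \<Sigma> (const c) = const c"
  by (simp add: const_def phi_single mon_image_def)

lemma phi_edge_var: "phi \<Sigma> (edge_var e) = edge_image \<Sigma> e"
  by (simp add: edge_var_def phi_single mon_image_def const_one)

lemma phi_ring_hom:
  assumes "oriented_signed_graph n \<Sigma>"
  shows "phi \<Sigma> \<in> ring_hom (edge_ring \<Sigma>) (laurent_ring n :: ((nat \<Rightarrow>\<^sub>0 int) \<Rightarrow>\<^sub>0 'k::field) ring)"
proof -
  let ?L = "laurent_ring n :: ((nat \<Rightarrow>\<^sub>0 int) \<Rightarrow>\<^sub>0 'k) ring"
  interpret L: cring ?L by (rule cring_poly_ring)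
  have zero: "0 \<in> carrier ?L" and one: "1 \<in> carrier ?L"
    using L.zero_closed L.one_closed by (simp_all add: poly_ring_def)
  have add: "p + q \<in> carrier ?L" and mult: "p * q \<in> carrier ?L"
    if "p \<in> carrier ?L" "q \<in> carrier ?L" for p q
    using L.a_closed[OF that] L.m_closed[OF that] by (simp_all add: poly_ring_def)
  have pow: "p ^ k \<in> carrier ?L" if "p \<in> carrier ?L" for p k
    using that by (induction k) (simp_all add: one mult del: One_nat_def)
  have sum: "sum f A \<in> carrier ?L" if "\<And>x. x \<in> A \<Longrightarrow> f x \<in> carrier ?L"
    for A and f :: "('a \<Rightarrow>\<^sub>0 nat) \<Rightarrow> _"
    using that by (induction A rule: infinite_finite_induct) (simp_all add: zero add del: One_nat_def)
  have prod: "prod f A \<in> carrier ?L" if "\<And>x. x \<in> A \<Longrightarrow> f x \<in> carrier ?L"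
    for A and f :: "'a \<Rightarrow> _"
    using that by (induction A rule: infinite_finite_induct) (simp_all add: one mult del: One_nat_def)
  have tpow: "tpow i z \<in> carrier ?L" if "i \<in> {1..n}" for i z
    using that by (auto simp: tpow_def poly_ring_def)
  have edge: "edge_image \<Sigma> e \<in> carrier ?L" if "e \<in> edges \<Sigma>" for e
  proof (cases "ends \<Sigma> e")
    case (Half i)
    then have "i \<in> {1..n}" using assms that by (auto simp: oriented_signed_graph_def)
    then show ?thesis using Half tpow by (simp add: edge_image_def)
  next
    case (Ends i j)
    then have "i \<in> {1..n}" "j \<in> {1..n}"
      using assms that by (auto simp: oriented_signed_graph_def)
    then show ?thesis using Ends mult[OF tpow tpow] by (simp add: edge_image_def)
  qed
  have const: "const c \<in> carrier ?L" for c
    by (auto simp: const_def poly_ring_def)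
  have "phi \<Sigma> p \<in> carrier ?L" if p: "p \<in> carrier (edge_ring \<Sigma>)" for p
    unfolding phi_def mon_image_def
    by (intro sum mult const prod pow edge) (use p in \<open>auto simp: poly_ring_def\<close>)
  then show ?thesis
    by (intro ring_hom_memI)
      (auto simp: poly_ring_def phi_add phi_mult phi_const[of \<Sigma> 1, unfolded const_one])
qed

end

theory Submission
  imports Defs "HOL-Library.Multiset"
begin

text \<open>
  The kernel is spanned by binomials, so let \<open>U\<^sup>a - U\<^sup>b\<close> be in the kernel with \<open>a\<close>, \<open>b\<close> coprime. Give
  the vertices \<open>i\<close> and \<open>- i\<close> of the covering the weights \<open>t\<^sub>i\<close> and \<open>1 / t\<^sub>i\<close>, and \<open>0\<close> the weight \<open>1\<close>;
  then \<open>\<phi> (U\<^sub>e)\<close> is the quotient of the weights of the tail and the head of either arc over \<open>e\<close>.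
  Walk greedily in the covering, following arcs over factors of \<open>a\<close> along and arcs over factors of
  \<open>b\<close> against their direction, each factor being used up by one step, until the walk closes up. It
  contains a cycle \<open>C\<close> whose two monomials divide \<open>U\<^sup>a\<close> and \<open>U\<^sup>b\<close>, and subtracting a multiple of
  \<open>U(C)\<close> leaves a multiple of a binomial of lower degree in the kernel. Cycles that are fixed
  orientation-wise have \<open>U(C) = 0\<close>.
\<close>

section \<open>Closed walks and cycles\<close>

text \<open>If a vertex repeats, the piece between two visits is a closed walk, shorter because it
  lies in the walk without its first arc. Inclusion of multisets, not of sets, preserves the bound
  on how often each label is consumed.\<close>

lemma (in wf_digraph) closed_awalk_imp_subcycle:
  assumes "awalk u p u" "p \<noteq> []"
  shows "\<exists>c. cycle c \<and> mset c \<subseteq># mset p"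
  using assms
proof (induction "length p" arbitrary: u p rule: less_induct)
  case less
  show ?case
  proof (cases "distinct (tl (awalk_verts u p))")
    case True
    then show ?thesis using less.prems by (auto simp: cycle_def)
  next
    case False
    obtain a q where p: "p = a # q" using less.prems(2) by (cases p) auto
    have q: "awalk (head G a) q u" "\<not> distinct (awalk_verts (head G a) q)"
      using less.prems(1) False p by (auto simp: awalk_Cons_iff)
    from awalk_not_distinct_decomp[OF q] obtain q1 r q2 w where
      r: "q = q1 @ r @ q2" "awalk w r w" "r \<noteq> []" by force
    have "length r < length p" using r p by simp
    from less.hyps[OF this r(2,3)] obtain c where "cycle c" "mset c \<subseteq># mset r" by blast
    moreover have "mset r \<subseteq># mset p"
      by (auto simp: p r subseteq_mset_def)
    ultimately show ?thesis using subset_mset.order_trans by blast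
  qed
qed

lemma wf_steps:
  assumes "wf_digraph D"
  shows "wf_digraph (steps D)"
proof -
  interpret wf_digraph D by fact
  show ?thesis by unfold_locales (auto simp: steps_def)
qed

section \<open>Weights\<close>

text \<open>The exponent vector of the weight: \<open>t_i\<close> for \<open>i\<close>, its inverse
  for \<open>- i\<close>. At \<open>0\<close> the value \<open>sgn 0 = 0\<close> makes it the zero
  vector, so the index \<open>0\<close> never occurs.\<close>

definition vertex_weight :: "int \<Rightarrow> nat \<Rightarrow>\<^sub>0 int" where
  "vertex_weight x = Poly_Mapping.single (nat \<bar>x\<bar>) (sgn x)"

lemma vertex_weight_minus: "vertex_weight (- x) = - vertex_weight x"
  by (simp add: vertex_weight_def single_uminus)

lemma lookup_vertex_weight:
  "Poly_Mapping.lookup (vertex_weight x) (nat \<bar>y\<bar>) = (if \<bar>x\<bar> = \<bar>y\<bar> then sgn x else 0)"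
  by (auto simp: vertex_weight_def lookup_single when_def)

definition edge_weight :: "'e osgraph \<Rightarrow> 'e \<Rightarrow> nat \<Rightarrow>\<^sub>0 int" where
  "edge_weight \<Sigma> e = vertex_weight (signed_end \<Sigma> e First) + vertex_weight (signed_end \<Sigma> e Second)"

text \<open>
  A pair \<open>M\<close> of monomials is encoded as one multiset of labelled edges: the label \<open>True\<close> marks the
  factors of the first monomial and \<open>False\<close> those of the second. Traversing an arc over \<open>e\<close>
  along (against) its direction consumes one copy of \<open>(e, True)\<close> (of \<open>(e, False)\<close>).
\<close>

definition step_label :: "('e \<times> side) \<times> bool \<Rightarrow> 'e \<times> bool" where
  "step_label x = (cov_proj (fst x), snd x)"

definition label_weight :: "'e osgraph \<Rightarrow> 'e \<times> bool \<Rightarrow> nat \<Rightarrow>\<^sub>0 int" where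
  "label_weight \<Sigma> x = (if snd x then edge_weight \<Sigma> (fst x) else - edge_weight \<Sigma> (fst x))"

text \<open>For labels over edges of \<Sigma> this vanishes iff the two encoded monomials have the
  same image under \<open>phi\<close>.\<close>

definition total_weight :: "'e osgraph \<Rightarrow> ('e \<times> bool) multiset \<Rightarrow> nat \<Rightarrow>\<^sub>0 int" where
  "total_weight \<Sigma> M = (\<Sum>x\<in>#M. label_weight \<Sigma> x)"

lemma total_weight_simps [simp]:
  "total_weight \<Sigma> {#} = 0"
  "total_weight \<Sigma> (add_mset x M) = label_weight \<Sigma> x + total_weight \<Sigma> M"
  "total_weight \<Sigma> (M + N) = total_weight \<Sigma> M + total_weight \<Sigma> N"
  by (simp_all add: total_weight_def)

lemma total_weight_sum: "total_weight \<Sigma> (sum f A) = (\<Sum>x\<in>A. total_weight \<Sigma> (f x))"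
  by (induction A rule: infinite_finite_induct) simp_all

text \<open>The head of an arc is the negative of the other signed end, which turns the difference
  into the sum of both end weights. Traversal against the arc flips the sign on both sides.\<close>

lemma label_weight_step_label:
  "label_weight \<Sigma> (step_label x)
   = vertex_weight (tail (steps (signed_covering n \<Sigma>)) x)
     - vertex_weight (head (steps (signed_covering n \<Sigma>)) x)"
proof -
  obtain e s d where "x = ((e, s), d)" by (cases x) auto
  then show ?thesis
    by (cases s) (auto simp: label_weight_def step_label_def cov_proj_def edge_weight_def steps_def
        signed_covering_def vertex_weight_minus)
qed

lemma total_weight_walk:
  assumes "pre_digraph.cas (steps (signed_covering n \<Sigma>)) u p v"
  shows "total_weight \<Sigma> (image_mset step_label (mset p)) = vertex_weight u - vertex_weight v"
  using assms
  by (induction p arbitrary: u)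
    (auto simp: pre_digraph.cas.simps label_weight_step_label[of _ _ n])

text \<open>In the coordinate of \<open>v\<close> the remaining weight has the sign of
  \<open>v\<close>, also when \<open>u = - v\<close>. Some label must contribute with that sign,
  hence so must one of its two ends, and a step can leave \<open>v\<close> there.\<close>

lemma exists_step:
  assumes "oriented_signed_graph n \<Sigma>" and R: "fst ` set_mset R \<subseteq> edges \<Sigma>"
    and v: "v \<noteq> 0" "v \<noteq> u" and total: "total_weight \<Sigma> R = vertex_weight v - vertex_weight u"
  shows "\<exists>x\<in>arcs (steps (signed_covering n \<Sigma>)).
    tail (steps (signed_covering n \<Sigma>)) x = v \<and> step_label x \<in># R"
proof -
  let ?l = "\<lambda>m. sgn v * Poly_Mapping.lookup m (nat \<bar>v\<bar>)"
  have l_total: "?l (total_weight \<Sigma> N) \<le> 0" if "\<forall>x\<in>#N. ?l (label_weight \<Sigma> x) \<le> 0" for N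
    using that by (induction N) (auto simp: lookup_add distrib_left)
  have "\<not> ?l (total_weight \<Sigma> R) \<le> 0"
    using v by (auto simp: total lookup_minus lookup_vertex_weight right_diff_distrib sgn_if
        split: if_splits)
  with l_total have "\<not> (\<forall>x\<in>#R. ?l (label_weight \<Sigma> x) \<le> 0)" by blast
  then obtain e d where ed: "(e, d) \<in># R" "?l (label_weight \<Sigma> (e, d)) > 0"
    by (auto simp: not_le)
  define \<delta> :: int where "\<delta> = (if d then 1 else - 1)"
  have "?l (vertex_weight (\<delta> * signed_end \<Sigma> e First)) + ?l (vertex_weight (\<delta> * signed_end \<Sigma> e Second)) > 0"
    using ed(2) by (cases d)
      (auto simp: \<delta>_def label_weight_def edge_weight_def vertex_weight_minus lookup_add lookup_minus
        algebra_simps)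
  then have "?l (vertex_weight (\<delta> * signed_end \<Sigma> e First)) > 0
      \<or> ?l (vertex_weight (\<delta> * signed_end \<Sigma> e Second)) > 0"
    by linarith
  then obtain s where s: "?l (vertex_weight (\<delta> * signed_end \<Sigma> e s)) > 0" by blast
  then have s_eq: "\<delta> * signed_end \<Sigma> e s = v"
    unfolding lookup_vertex_weight by (auto simp: sgn_if abs_if split: if_splits)
  \<comment> \<open>A step against an arc starts at its head, the negative of the other signed end;
    hence \<open>other s\<close> when \<open>d\<close> is false. An equal-sign loop has only the arc
    \<open>First\<close>.\<close>
  define s' where "s' = (if equal_sign_loop \<Sigma> e then First else if d then s else other s)"
  let ?x = "((e, s'), d)"
  have "e \<in> edges \<Sigma>" using R ed(1) by force
  then have "?x \<in> arcs (steps (signed_covering n \<Sigma>))"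
    by (simp add: steps_def signed_covering_def s'_def)
  moreover have "tail (steps (signed_covering n \<Sigma>)) ?x = v"
  proof (cases "equal_sign_loop \<Sigma> e")
    case True
    then have "signed_end \<Sigma> e t = signed_end \<Sigma> e s" for t
      by (rule signed_end_equal_sign_loop)
    then show ?thesis
      using s_eq by (auto simp: \<delta>_def steps_def signed_covering_def split: if_splits)
  next
    case False
    then show ?thesis
      using s_eq by (auto simp: \<delta>_def s'_def steps_def signed_covering_def split: if_splits)
  qed
  moreover have "step_label ?x \<in># R"
    using ed(1) by (simp add: step_label_def cov_proj_def)
  ultimately show ?thesis by blast
qed

text \<open>
  A walk from \<open>u\<close> to \<open>v\<close> that respects the multiplicities of \<open>M\<close> leaves a remainder of weight
  \<open>v - u\<close>, so it can be continued unless \<open>v = u\<close> or \<open>v = 0\<close>. The vertex \<open>0\<close> carries no weight;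
  hence the walk must start there if it can reach it.
\<close>

lemma exists_closed_walk_from:
  assumes \<Sigma>: "oriented_signed_graph n \<Sigma>"
    and M: "fst ` set_mset M \<subseteq> edges \<Sigma>" "total_weight \<Sigma> M = 0"
    and zero: "u = 0 \<or> (\<forall>x\<in>arcs (steps (signed_covering n \<Sigma>)).
      step_label x \<in># M \<longrightarrow> head (steps (signed_covering n \<Sigma>)) x \<noteq> 0)"
    and p: "pre_digraph.awalk (steps (signed_covering n \<Sigma>)) u p v" "p \<noteq> []"
      "image_mset step_label (mset p) \<subseteq># M"
  shows "\<exists>q. pre_digraph.awalk (steps (signed_covering n \<Sigma>)) u q u \<and> q \<noteq> [] \<and>
    image_mset step_label (mset q) \<subseteq># M"
  using p
proof (induction "size M - length p" arbitrary: p v rule: less_induct)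
  case less
  let ?G = "steps (signed_covering n \<Sigma>)"
  interpret wf_digraph ?G
    by (intro wf_steps wf_signed_covering[OF \<Sigma>])
  show ?case
  proof (cases "v = u")
    case True
    then show ?thesis using less.prems by blast
  next
    case False
    obtain q y where q: "p = q @ [y]" using less.prems(2) by (cases p rule: rev_cases) auto
    \<comment> \<open>The last step enters \<open>v\<close> with a label of \<open>M\<close>. By
      \<open>zero\<close>, a walk that starts elsewhere than at \<open>0\<close> therefore cannot
      have reached \<open>0\<close>.\<close>
    have y: "y \<in> arcs ?G" "head ?G y = v" "step_label y \<in># M"
      using less.prems(1,3) unfolding q by (auto simp: awalk_simps dest: mset_subset_eqD)
    with zero False have "v \<noteq> 0" by blast
    obtain R where R: "M = image_mset step_label (mset p) + R"
      using less.prems(3) by (auto simp: mset_subset_eq_exists_conv)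
    have "cas u p v" using less.prems(1) by auto
    from total_weight_walk[OF this] M(2) R
    have total: "total_weight \<Sigma> R = vertex_weight v - vertex_weight u"
      by (simp add: algebra_simps add_eq_0_iff)
    have "fst ` set_mset R \<subseteq> edges \<Sigma>" using M(1) R by auto
    from exists_step[OF \<Sigma> this \<open>v \<noteq> 0\<close> False total] obtain x where
      x: "x \<in> arcs ?G" "tail ?G x = v" "step_label x \<in># R" by blast
    have "awalk u (p @ [x]) (head ?G x)"
      using less.prems(1) x by (auto simp: awalk_simps)
    moreover have sub: "image_mset step_label (mset (p @ [x])) \<subseteq># M"
      using x(3) by (simp add: R)
    \<comment> \<open>The truncated subtraction drops strictly because the prolonged walk still uses
      at most \<open>size M\<close> labels.\<close>
    moreover have "size M - length (p @ [x]) < size M - length p"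
      using size_mset_mono[OF sub] by simp
    ultimately show ?thesis using less.hyps by blast
  qed
qed

lemma exists_closed_walk:
  assumes \<Sigma>: "oriented_signed_graph n \<Sigma>"
    and M: "fst ` set_mset M \<subseteq> edges \<Sigma>" "total_weight \<Sigma> M = 0" "M \<noteq> {#}"
  shows "\<exists>u q. pre_digraph.awalk (steps (signed_covering n \<Sigma>)) u q u \<and> q \<noteq> [] \<and>
    image_mset step_label (mset q) \<subseteq># M"
proof -
  let ?G = "steps (signed_covering n \<Sigma>)"
  let ?avoid = "\<forall>x\<in>arcs ?G. step_label x \<in># M \<longrightarrow> head ?G x \<noteq> 0"
  interpret wf_digraph ?G
    by (intro wf_steps wf_signed_covering[OF \<Sigma>])
  have "\<exists>x\<in>arcs ?G. step_label x \<in># M \<and> (tail ?G x = 0 \<or> ?avoid)"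
  proof (cases ?avoid)
    case True
    obtain e d where ed: "(e, d) \<in># M" using M(3) by fastforce
    then have "((e, First), d) \<in> arcs ?G" "step_label ((e, First), d) \<in># M"
      using M(1) by (force simp: steps_def signed_covering_def step_label_def cov_proj_def)+
    with True show ?thesis by blast
  next
    case False
    then obtain a d where x: "(a, d) \<in> arcs ?G" "step_label (a, d) \<in># M" "head ?G (a, d) = 0"
      by force
    \<comment> \<open>Applying \<open>iota\<close> while keeping \<open>d\<close> negates and swaps
      the two ends, so a step into \<open>0\<close> becomes a step out of \<open>0\<close> with the
      same label. The walk can then start at \<open>0\<close>.\<close>
    have "(iota \<Sigma> a, d) \<in> arcs ?G"
      using x(1) iota_in_arcs[of a n \<Sigma>] by (simp add: steps_def)
    moreover have "tail ?G (iota \<Sigma> a, d) = 0"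
      using x(3) by (cases d) (simp_all add: steps_def tail_iota head_iota)
    moreover have "step_label (iota \<Sigma> a, d) = step_label (a, d)"
      by (cases a) (simp add: step_label_def cov_proj_def iota_def)
    ultimately show ?thesis using x(2) by metis
  qed
  then obtain x where x: "x \<in> arcs ?G" "step_label x \<in># M" "tail ?G x = 0 \<or> ?avoid"
    by blast
  have "awalk (tail ?G x) [x] (head ?G x)" using x(1) by (simp add: awalk_simps)
  moreover have "image_mset step_label (mset [x]) \<subseteq># M" using x(2) by simp
  ultimately show ?thesis
    using exists_closed_walk_from[OF \<Sigma> M(1,2) x(3)] by blast
qed

text \<open>Coprimality prevents the cycle from traversing one arc back and forth, since this would
  consume both \<open>(e, True)\<close> and \<open>(e, False)\<close>.\<close>

lemma exists_cycle:
  assumes \<Sigma>: "oriented_signed_graph n \<Sigma>"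
    and M: "fst ` set_mset M \<subseteq> edges \<Sigma>" "total_weight \<Sigma> M = 0" "M \<noteq> {#}"
    and coprime: "\<And>e. (e, True) \<in># M \<Longrightarrow> (e, False) \<notin># M"
  shows "\<exists>C. undirected_cycle (signed_covering n \<Sigma>) C \<and> image_mset step_label (mset C) \<subseteq># M"
proof -
  let ?G = "steps (signed_covering n \<Sigma>)"
  interpret wf_digraph ?G
    by (intro wf_steps wf_signed_covering[OF \<Sigma>])
  obtain u q where q: "awalk u q u" "q \<noteq> []" "image_mset step_label (mset q) \<subseteq># M"
    using exists_closed_walk[OF \<Sigma> M] by blast
  then obtain C where C: "cycle C" "mset C \<subseteq># mset q"
    using closed_awalk_imp_subcycle by blast
  have CM: "image_mset step_label (mset C) \<subseteq># M"
    using image_mset_subseteq_mono[OF C(2)] q(3) by (rule subset_mset.order_trans)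
  have in_M: "(cov_proj a, d) \<in># M" if "(a, d) \<in> set C" for a d
    using mset_subset_eqD[OF CM, of "step_label (a, d)"] that by (force simp: step_label_def)
  have "inj_on fst (set C)"
  proof (rule inj_onI)
    fix x y assume xy: "x \<in> set C" "y \<in> set C" "fst x = fst y"
    then obtain a d d' where "x = (a, d)" "y = (a, d')" by (metis prod.collapse)
    with xy show "x = y"
      using in_M[of a True] in_M[of a False] coprime[of "cov_proj a"] by (cases d; cases d') auto
  qed
  moreover have "distinct C"
    using C(1) distinct_tl_verts_imp_distinct by (auto simp: cycle_def)
  ultimately show ?thesis
    using C(1) CM by (auto simp: undirected_cycle_def distinct_map)
qed

section \<open>Binomials\<close>

definition label_monomial :: "bool \<Rightarrow> ('e \<times> bool) multiset \<Rightarrow> ('e \<Rightarrow>\<^sub>0 nat) \<Rightarrow>\<^sub>0 'k::comm_ring_1" where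
  "label_monomial d M = (\<Prod>x\<in>#filter_mset (\<lambda>x. snd x = d) M. edge_var (fst x))"

definition label_binomial :: "('e \<times> bool) multiset \<Rightarrow> ('e \<Rightarrow>\<^sub>0 nat) \<Rightarrow>\<^sub>0 'k::comm_ring_1" where
  "label_binomial M = label_monomial True M - label_monomial False M"

lemma label_monomial_simps [simp]:
  "label_monomial d {#} = 1"
  "label_monomial d (add_mset x M) = (if snd x = d then edge_var (fst x) else 1) * label_monomial d M"
  "label_monomial d (M + N) = label_monomial d M * label_monomial d N"
  by (simp_all add: label_monomial_def)

text \<open>The identity \<open>x x' - y y' = x' (x - y) + y (x' - y')\<close>, which reduces ideal
  membership to the parts of a decomposition.\<close>

lemma label_binomial_add:
  "label_binomial (M + N)
   = label_monomial True N * label_binomial M + label_monomial False M * label_binomial N"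
  by (simp add: label_binomial_def algebra_simps)

text \<open>As no arc repeats, products over sets of arcs lose no multiplicity; two arcs over the
  same edge still give two factors.\<close>

lemma cycle_binomial_eq_label_binomial:
  fixes C :: "(('e \<times> side) \<times> bool) list"
  assumes "distinct (map fst C)"
  shows "cycle_binomial C
    = (label_binomial (image_mset step_label (mset C)) :: ('e \<Rightarrow>\<^sub>0 nat) \<Rightarrow>\<^sub>0 'k::comm_ring_1)"
proof -
  have "(\<Prod>a\<in>{a. (a, d) \<in> set C}. edge_var (cov_proj a) :: ('e \<Rightarrow>\<^sub>0 nat) \<Rightarrow>\<^sub>0 'k)
      = label_monomial d (image_mset step_label (mset C))" for d
    using assms
  proof (induction C)
    case (Cons x C)
    have fin: "finite {a. (a, d) \<in> set C}"
      by (rule finite_subset[of _ "fst ` set C"]) force+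
    have "(fst x, d) \<notin> set C"
      using Cons.prems image_eqI[of "fst x" fst "(fst x, d)" "set C"] by auto
    moreover have "{a. (a, d) \<in> set (x # C)} =
        (if snd x = d then insert (fst x) {a. (a, d) \<in> set C} else {a. (a, d) \<in> set C})"
      by (cases x) auto
    ultimately show ?case
      using Cons fin by (auto simp: step_label_def)
  qed simp
  then show ?thesis
    by (simp add: cycle_binomial_def label_binomial_def along_def against_def)
qed

text \<open>Since \<open>iota\<close> reverses the sense of traversal, being fixed means that
  \<open>iota\<close> maps \<open>against C\<close> onto \<open>along C\<close>. It is injective and
  preserves \<open>cov_proj\<close>, so both products agree.\<close>

lemma cycle_binomial_fixed:
  assumes "fixed_orientationwise \<Sigma> C"
  shows "cycle_binomial C = 0"
proof -
  have "along (iota_cycle \<Sigma> C) = iota \<Sigma> ` against C"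
    by (force simp: along_def against_def iota_cycle_def)
  then have "along C = iota \<Sigma> ` against C"
    using assms by (simp add: fixed_orientationwise_def)
  moreover have "inj_on (iota \<Sigma>) (against C)"
    by (metis inj_onI iota_iota)
  moreover have "cov_proj (iota \<Sigma> a) = cov_proj a" for a
    by (cases a) (simp add: cov_proj_def iota_def)
  ultimately show ?thesis
    by (simp add: cycle_binomial_def prod.reindex)
qed

section \<open>The map \<open>phi\<close> on monomials\<close>

lemma edge_image_eq:
  assumes "oriented_signed_graph n \<Sigma>" "e \<in> edges \<Sigma>"
  shows "edge_image \<Sigma> e = Poly_Mapping.single (edge_weight \<Sigma> e) 1"
proof (cases "ends \<Sigma> e")
  case (Half i)
  \<comment> \<open>Because \<open>i\<close> is positive, \<open>sgn\<close> and the absolute value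
    recover the incidence sign and \<open>i\<close> from the signed end.\<close>
  then have "bidir \<Sigma> e First \<in> {1, - 1}" "i \<ge> 1"
    using assms by (auto simp: oriented_signed_graph_def)
  then show ?thesis
    using Half by (auto simp: edge_image_def tpow_def edge_weight_def signed_end_def vertex_weight_def)
next
  case (Ends i j)
  then have "bidir \<Sigma> e First \<in> {1, - 1}" "bidir \<Sigma> e Second \<in> {1, - 1}" "i \<ge> 1" "j \<ge> 1"
    using assms by (auto simp: oriented_signed_graph_def)
  then show ?thesis
    using Ends by (auto simp: edge_image_def tpow_def edge_weight_def signed_end_def vertex_weight_def
        mult_single)
qed

text \<open>Puts a whole monomial on one side, so that
  \<open>labels True m + labels False m'\<close> encodes the pair \<open>m\<close>,
  \<open>m'\<close>.\<close>

definition labels :: "bool \<Rightarrow> ('e \<Rightarrow>\<^sub>0 nat) \<Rightarrow> ('e \<times> bool) multiset" where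
  "labels d m = (\<Sum>e\<in>Poly_Mapping.keys m. replicate_mset (Poly_Mapping.lookup m e) (e, d))"

lemma set_labels: "fst ` set_mset (labels d m) \<subseteq> Poly_Mapping.keys m"
  by (force simp: labels_def set_mset_sum split: if_splits)

lemma prod_single_one:
  "(\<Prod>x\<in>A. Poly_Mapping.single (f x) (1 :: 'k::comm_ring_1)) = Poly_Mapping.single (\<Sum>x\<in>A. f x) 1"
  by (induction A rule: infinite_finite_induct) (simp_all add: mult_single)

lemma label_monomial_labels:
  "label_monomial d (labels d' m)
   = (if d = d' then Poly_Mapping.single m (1 :: 'k::comm_ring_1) else 1)"
proof -
  have sum: "label_monomial d (\<Sum>e\<in>A. f e) = (\<Prod>e\<in>A. label_monomial d (f e))"
    for A :: "'a set" and f :: "'a \<Rightarrow> ('a \<times> bool) multiset"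
    by (induction A rule: infinite_finite_induct) simp_all
  have rep: "label_monomial d (replicate_mset k (e, d'))
      = (if d = d' then Poly_Mapping.single (Poly_Mapping.single e k) (1 :: 'k) else 1)" for k and e :: 'a
    by (induction k) (auto simp: edge_var_def mult_single single_add[symmetric])
  show ?thesis
    using poly_mapping_sum_single[of m] by (simp add: labels_def sum rep prod_single_one)
qed

lemma total_weight_labels_False:
  "total_weight \<Sigma> (labels False m) = - total_weight \<Sigma> (labels True m)"
proof -
  have rep: "total_weight \<Sigma> (replicate_mset k (e, False)) = - total_weight \<Sigma> (replicate_mset k (e, True))"
    for k e
    by (induction k) (simp_all add: label_weight_def)
  show ?thesis
    by (simp add: labels_def total_weight_sum rep sum_negf)
qed

lemma mon_image_eq:
  assumes "oriented_signed_graph n \<Sigma>" "Poly_Mapping.keys m \<subseteq> edges \<Sigma>"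
  shows "mon_image \<Sigma> m = Poly_Mapping.single (total_weight \<Sigma> (labels True m)) 1"
proof -
  have rep: "edge_image \<Sigma> e ^ k = Poly_Mapping.single (total_weight \<Sigma> (replicate_mset k (e, True))) 1"
    if "e \<in> edges \<Sigma>" for k e
    by (induction k) (simp_all add: label_weight_def edge_image_eq[OF assms(1) that] mult_single)
  have "mon_image \<Sigma> m = (\<Prod>e\<in>Poly_Mapping.keys m.
      Poly_Mapping.single (total_weight \<Sigma> (replicate_mset (Poly_Mapping.lookup m e) (e, True))) 1)"
    unfolding mon_image_def using assms(2) by (intro prod.cong refl rep) auto
  then show ?thesis
    by (simp add: labels_def total_weight_sum prod_single_one)
qed

lemma phi_label_monomial:
  assumes "oriented_signed_graph n \<Sigma>" "fst ` set_mset M \<subseteq> edges \<Sigma>"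
  shows "phi \<Sigma> (label_monomial d M) = Poly_Mapping.single (\<Sum>x\<in>#filter_mset (\<lambda>x. snd x = d) M. edge_weight \<Sigma> (fst x)) 1"
proof -
  have "phi \<Sigma> 1 = 1" using phi_const[of \<Sigma> 1] by (simp add: const_one)
  then show ?thesis
    using assms(2)
    by (induction M) (auto simp: phi_mult phi_edge_var edge_image_eq[OF assms(1)] mult_single)
qed

lemma phi_label_binomial:
  assumes "oriented_signed_graph n \<Sigma>" "fst ` set_mset M \<subseteq> edges \<Sigma>" "total_weight \<Sigma> M = 0"
  shows "phi \<Sigma> (label_binomial M) = (0 :: (nat \<Rightarrow>\<^sub>0 int) \<Rightarrow>\<^sub>0 'k::comm_ring_1)"
proof -
  let ?w = "\<lambda>d M. \<Sum>x\<in>#filter_mset (\<lambda>x. snd x = d) M. edge_weight \<Sigma> (fst x)"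
  have "total_weight \<Sigma> M = ?w True M - ?w False M"
    by (induction M) (auto simp: label_weight_def)
  with assms(3) have "?w True M = ?w False M" by simp
  moreover have "phi \<Sigma> (p - q) = phi \<Sigma> p - phi \<Sigma> q" for p q :: "('a \<Rightarrow>\<^sub>0 nat) \<Rightarrow>\<^sub>0 'k"
    using phi_add[of \<Sigma> "p - q" q] by simp
  ultimately show ?thesis
    by (simp add: label_binomial_def phi_label_monomial[OF assms(1,2)])
qed

section \<open>Ideals of the polynomial ring in terms of the type class operations\<close>

lemma
  assumes "ideal J (poly_ring X)"
  shows ideal_poly_ring_zero: "0 \<in> J"
    and ideal_poly_ring_add: "p \<in> J \<Longrightarrow> q \<in> J \<Longrightarrow> p + q \<in> J"
    and ideal_poly_ring_mult: "p \<in> J \<Longrightarrow> r \<in> carrier (poly_ring X) \<Longrightarrow> r * p \<in> J"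
  using additive_subgroup.zero_closed[OF ideal.axioms(1)[OF assms]]
    additive_subgroup.a_closed[OF ideal.axioms(1)[OF assms], of p q]
    ideal.I_l_closed[OF assms, of p r]
  by (simp_all add: poly_ring_def)

lemma label_monomial_closed:
  assumes "fst ` set_mset M \<subseteq> X"
  shows "label_monomial d M \<in> carrier (poly_ring X :: (('e \<Rightarrow>\<^sub>0 nat) \<Rightarrow>\<^sub>0 'k::comm_ring_1) ring)"
proof -
  let ?R = "poly_ring X :: (('e \<Rightarrow>\<^sub>0 nat) \<Rightarrow>\<^sub>0 'k) ring"
  interpret R: cring ?R by (rule cring_poly_ring)
  have one: "1 \<in> carrier ?R" using R.one_closed by (simp add: poly_ring_def)
  have mult: "p * q \<in> carrier ?R" if "p \<in> carrier ?R" "q \<in> carrier ?R" for p q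
    using R.m_closed[OF that] by (simp add: poly_ring_def)
  have var: "edge_var e \<in> carrier ?R" if "e \<in> X" for e
    using that by (auto simp: edge_var_def poly_ring_def)
  show ?thesis
    using assms by (induction M) (auto simp: one mult var simp del: One_nat_def)
qed

lemma label_binomial_closed:
  assumes "fst ` set_mset M \<subseteq> X"
  shows "label_binomial M \<in> carrier (poly_ring X :: (('e \<Rightarrow>\<^sub>0 nat) \<Rightarrow>\<^sub>0 'k::comm_ring_1) ring)"
proof -
  let ?R = "poly_ring X :: (('e \<Rightarrow>\<^sub>0 nat) \<Rightarrow>\<^sub>0 'k) ring"
  interpret R: cring ?R by (rule cring_poly_ring)
  have minus: "- p \<in> carrier ?R" if "p \<in> carrier ?R" for p
    using that by (auto simp: poly_ring_def in_keys_iff)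
  have add: "p + q \<in> carrier ?R" if "p \<in> carrier ?R" "q \<in> carrier ?R" for p q
    using R.a_closed[OF that] by (simp add: poly_ring_def)
  show ?thesis
    using add[OF label_monomial_closed[OF assms] minus[OF label_monomial_closed[OF assms]]]
    by (simp add: label_binomial_def)
qed

section \<open>Generation by cycle binomials\<close>

lemma labels_of_cycle_in_edges:
  assumes "undirected_cycle (signed_covering n \<Sigma>) C"
  shows "fst ` set_mset (image_mset step_label (mset C)) \<subseteq> edges \<Sigma>"
proof -
  have "set C \<subseteq> arcs (steps (signed_covering n \<Sigma>))"
    using assms by (auto simp: undirected_cycle_def pre_digraph.cycle_def pre_digraph.awalk_def)
  then show ?thesis
    by (force simp: steps_def signed_covering_def step_label_def cov_proj_def)
qed

lemma total_weight_cycle: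
  assumes "undirected_cycle (signed_covering n \<Sigma>) C"
  shows "total_weight \<Sigma> (image_mset step_label (mset C)) = 0"
  using assms total_weight_walk[of n \<Sigma> _ C]
  by (fastforce simp: undirected_cycle_def pre_digraph.cycle_def pre_digraph.awalk_def)

text \<open>Induction on the number of factors: split off a common factor of the two monomials or,
  if they are coprime, a cycle. What remains again has weight zero.\<close>

lemma label_binomial_in_ideal:
  fixes J :: "(('e \<Rightarrow>\<^sub>0 nat) \<Rightarrow>\<^sub>0 'k::comm_ring_1) set"
  assumes \<Sigma>: "oriented_signed_graph n \<Sigma>" and J: "ideal J (poly_ring (edges \<Sigma>))"
    and cycles: "\<And>C. undirected_cycle (signed_covering n \<Sigma>) C \<Longrightarrow> cycle_binomial C \<in> J"
    and M: "fst ` set_mset M \<subseteq> edges \<Sigma>" "total_weight \<Sigma> M = 0"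
  shows "label_binomial M \<in> J"
  using M
proof (induction "size M" arbitrary: M rule: less_induct)
  case less
  note zero = ideal_poly_ring_zero[OF J] and add = ideal_poly_ring_add[OF J]
    and mult = ideal_poly_ring_mult[OF J]
  have split: "label_binomial M \<in> J"
    if "M = L + N" "label_binomial L \<in> J" "label_binomial N \<in> J" for L N
  proof -
    have "fst ` set_mset L \<subseteq> edges \<Sigma>" "fst ` set_mset N \<subseteq> edges \<Sigma>"
      using less.prems(1) that(1) by auto
    then show ?thesis
      unfolding that(1) label_binomial_add by (intro add mult label_monomial_closed that)
  qed
  show ?case
  proof (cases "M = {#}")
    case True
    then show ?thesis using zero by (simp add: label_binomial_def)
  next
    case nonempty: False
    show ?thesis
    proof (cases "\<exists>e. (e, True) \<in># M \<and> (e, False) \<in># M")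
      case True
      then obtain e where e: "(e, True) \<in># M" "(e, False) \<in># M" by blast
      then have "{#(e, True), (e, False)#} \<subseteq># M"
        by (simp add: insert_subset_eq_iff in_diff_count)
      then obtain N where N: "M = {#(e, True), (e, False)#} + N"
        by (auto simp only: mset_subset_eq_exists_conv)
      have "label_binomial N \<in> J"
        using less.prems by (intro less.hyps) (auto simp: N label_weight_def)
      \<comment> \<open>Both monomials of this pair are the variable of \<open>e\<close>.\<close>
      moreover have "label_binomial {#(e, True), (e, False)#} \<in> J"
        using zero by (simp add: label_binomial_def)
      ultimately show ?thesis using split N by blast
    next
      case False
      then obtain C where C: "undirected_cycle (signed_covering n \<Sigma>) C"
        "image_mset step_label (mset C) \<subseteq># M"
        using exists_cycle[OF \<Sigma> less.prems nonempty] by blast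
      then obtain N where N: "M = image_mset step_label (mset C) + N"
        by (auto simp: mset_subset_eq_exists_conv)
      have "C \<noteq> []" "distinct (map fst C)"
        using C(1) by (auto simp: undirected_cycle_def pre_digraph.cycle_def)
      have "label_binomial N \<in> J"
        using less.prems total_weight_cycle[OF C(1)] \<open>C \<noteq> []\<close>
        by (intro less.hyps) (auto simp: N)
      moreover have "label_binomial (image_mset step_label (mset C)) \<in> J"
        using cycles[OF C(1)] cycle_binomial_eq_label_binomial[OF \<open>distinct (map fst C)\<close>] by metis
      ultimately show ?thesis using split N by blast
    qed
  qed
qed

text \<open>Induction on the number of terms. Cancellation in \<open>phi \<Sigma> p\<close> forces
  two monomials of \<open>p\<close> to have the same image; a multiple of their difference removes
  one term.\<close>

lemma kernel_subset_ideal: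
  fixes J :: "(('e \<Rightarrow>\<^sub>0 nat) \<Rightarrow>\<^sub>0 'k::comm_ring_1) set"
  assumes \<Sigma>: "oriented_signed_graph n \<Sigma>" and J: "ideal J (poly_ring (edges \<Sigma>))"
    and cycles: "\<And>C. undirected_cycle (signed_covering n \<Sigma>) C \<Longrightarrow> cycle_binomial C \<in> J"
    and p: "p \<in> carrier (poly_ring (edges \<Sigma>))" "phi \<Sigma> p = 0"
  shows "p \<in> J"
  using p
proof (induction "card (Poly_Mapping.keys p)" arbitrary: p rule: less_induct)
  case less
  note zero = ideal_poly_ring_zero[OF J] and add = ideal_poly_ring_add[OF J]
    and mult = ideal_poly_ring_mult[OF J]
  show ?case
  proof (cases "p = 0")
    case True
    then show ?thesis using zero by simp
  next
    case False
    then obtain m where m: "m \<in> Poly_Mapping.keys p" using keys_eq_empty by fastforce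
    let ?w = "\<lambda>m. total_weight \<Sigma> (labels True m)"
    let ?c = "Poly_Mapping.lookup p m"
    have keys: "Poly_Mapping.keys m' \<subseteq> edges \<Sigma>" if "m' \<in> Poly_Mapping.keys p" for m'
      using less.prems(1) that by (auto simp: poly_ring_def)
    have "phi \<Sigma> p = (\<Sum>m'\<in>Poly_Mapping.keys p. Poly_Mapping.single (?w m') (Poly_Mapping.lookup p m'))"
      unfolding phi_def
      by (intro sum.cong refl) (simp add: mon_image_eq[OF \<Sigma> keys] const_def mult_single)
    \<comment> \<open>The coefficient of \<open>phi \<Sigma> p\<close> at the exponent
      \<open>?w m\<close>.\<close>
    then have sum0: "(\<Sum>m'\<in>Poly_Mapping.keys p. if ?w m' = ?w m then Poly_Mapping.lookup p m' else 0) = 0"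
      using arg_cong[where f = "\<lambda>q. Poly_Mapping.lookup q (?w m)", OF less.prems(2)]
      by (simp add: lookup_sum lookup_single when_def)
    have "\<exists>m'\<in>Poly_Mapping.keys p. m' \<noteq> m \<and> ?w m' = ?w m"
    proof (rule ccontr)
      assume "\<not> ?thesis"
      then have "(\<Sum>m'\<in>Poly_Mapping.keys p. if ?w m' = ?w m then Poly_Mapping.lookup p m' else 0)
          = (\<Sum>m'\<in>Poly_Mapping.keys p. if m' = m then ?c else 0)"
        by (intro sum.cong) auto
      with sum0 m show False by (simp add: in_keys_iff)
    qed
    then obtain m' where m': "m' \<in> Poly_Mapping.keys p" "m' \<noteq> m" "?w m' = ?w m" by blast
    let ?M = "labels True m + labels False m'"
    have M: "fst ` set_mset ?M \<subseteq> edges \<Sigma>" "total_weight \<Sigma> ?M = 0"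
      using set_labels[of True m] set_labels[of False m'] keys[OF m] keys[OF m'(1)] m'(3)
      by (auto simp: total_weight_labels_False image_Un)
    define b :: "('e \<Rightarrow>\<^sub>0 nat) \<Rightarrow>\<^sub>0 'k" where "b = label_binomial ?M"
    have b: "b = Poly_Mapping.single m 1 - Poly_Mapping.single m' 1"
      by (simp add: b_def label_binomial_def label_monomial_labels)
    have c: "const ?c \<in> carrier (poly_ring (edges \<Sigma>))"
      by (auto simp: const_def poly_ring_def)
    have "b \<in> J"
      unfolding b_def using label_binomial_in_ideal[OF \<Sigma> J cycles M] by blast
    then have bJ: "const ?c * b \<in> J"
      by (rule mult[OF _ c])
    have cb: "const ?c * b = Poly_Mapping.single m ?c - Poly_Mapping.single m' ?c"
      by (simp add: b const_def right_diff_distrib mult_single)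
    let ?q = "p - const ?c * b"
    have lookup_q: "Poly_Mapping.lookup ?q k
        = Poly_Mapping.lookup p k - (?c when m = k) + (?c when m' = k)" for k
      by (simp add: cb lookup_minus lookup_single)
    \<comment> \<open>The term at \<open>m\<close> cancels, and \<open>m'\<close> already occurs in
      \<open>p\<close>, so no new monomial appears.\<close>
    have keys_q: "Poly_Mapping.keys ?q \<subseteq> Poly_Mapping.keys p - {m}"
      using m'(1,2) by (auto simp: in_keys_iff lookup_q when_def split: if_splits)
    have "card (Poly_Mapping.keys ?q) < card (Poly_Mapping.keys p)"
      using keys_q m by (intro psubset_card_mono) auto
    moreover have "?q \<in> carrier (poly_ring (edges \<Sigma>))"
      using keys_q keys by (auto simp: poly_ring_def)
    moreover have "phi \<Sigma> ?q = 0"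
    proof -
      have "phi \<Sigma> b = 0" unfolding b_def by (rule phi_label_binomial[OF \<Sigma> M])
      then show ?thesis
        using phi_add[of \<Sigma> ?q "const ?c * b"] less.prems(2) by (simp add: phi_mult)
    qed
    ultimately have "?q \<in> J" by (rule less.hyps)
    from add[OF this bJ] show ?thesis by simp
  qed
qed

theorem mainTheorem1:
  fixes n :: nat and \<Sigma> :: "'e osgraph"
  assumes "oriented_signed_graph n \<Sigma>"
  shows "(toric_ideal n \<Sigma> :: (('e \<Rightarrow>\<^sub>0 nat) \<Rightarrow>\<^sub>0 'k::field) set) =
    Idl\<^bsub>edge_ring \<Sigma>\<^esub>
      {cycle_binomial C | C. undirected_cycle (signed_covering n \<Sigma>) C \<and> \<not> fixed_orientationwise \<Sigma> C}"
proof -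
  let ?R = "edge_ring \<Sigma> :: (('e \<Rightarrow>\<^sub>0 nat) \<Rightarrow>\<^sub>0 'k) ring"
  let ?L = "laurent_ring n :: ((nat \<Rightarrow>\<^sub>0 int) \<Rightarrow>\<^sub>0 'k) ring"
  let ?S = "{cycle_binomial C | C. undirected_cycle (signed_covering n \<Sigma>) C
    \<and> \<not> fixed_orientationwise \<Sigma> C} :: (('e \<Rightarrow>\<^sub>0 nat) \<Rightarrow>\<^sub>0 'k) set"
  interpret R: cring ?R by (rule cring_poly_ring)
  interpret L: cring ?L by (rule cring_poly_ring)
  have "ring_hom_ring ?R ?L (phi \<Sigma>)"
    by (rule ring_hom_ringI2[OF R.ring_axioms L.ring_axioms phi_ring_hom[OF assms]])
  from ring_hom_ring.kernel_is_ideal[OF this]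
  have toric: "ideal (toric_ideal n \<Sigma>) ?R" by (simp only: toric_ideal_def)
  have kernel: "toric_ideal n \<Sigma> = {p \<in> carrier ?R. phi \<Sigma> p = 0}"
    by (simp add: toric_ideal_def a_kernel_def' poly_ring_def)
  have S: "?S \<subseteq> toric_ideal n \<Sigma>"
  proof
    fix p assume "p \<in> ?S"
    then obtain C where C: "undirected_cycle (signed_covering n \<Sigma>) C" "p = cycle_binomial C" by blast
    have p: "p = label_binomial (image_mset step_label (mset C))"
      using C cycle_binomial_eq_label_binomial[of C] by (simp add: undirected_cycle_def)
    show "p \<in> toric_ideal n \<Sigma>"
      unfolding kernel p
      using label_binomial_closed[OF labels_of_cycle_in_edges[OF C(1)]]
        phi_label_binomial[OF assms labels_of_cycle_in_edges[OF C(1)] total_weight_cycle[OF C(1)]]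
      by simp
  qed
  then have carrier: "?S \<subseteq> carrier ?R" unfolding kernel by blast
  note J = R.genideal_ideal[OF carrier] and SJ = R.genideal_self[OF carrier]
  \<comment> \<open>Cycles that are fixed orientation-wise contribute \<open>0\<close>, so the
    generated ideal contains the binomials of all cycles, as \<open>kernel_subset_ideal\<close>
    demands.\<close>
  have "cycle_binomial C \<in> Idl\<^bsub>?R\<^esub> ?S" if "undirected_cycle (signed_covering n \<Sigma>) C" for C
  proof (cases "fixed_orientationwise \<Sigma> C")
    case True
    show ?thesis
      unfolding cycle_binomial_fixed[OF True] by (rule ideal_poly_ring_zero[OF J])
  next
    case False
    then show ?thesis using SJ that by blast
  qed
  then have "toric_ideal n \<Sigma> \<subseteq> Idl\<^bsub>?R\<^esub> ?S"
    unfolding kernel using kernel_subset_ideal[OF assms J] by blast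
  moreover have "Idl\<^bsub>?R\<^esub> ?S \<subseteq> toric_ideal n \<Sigma>"
    by (rule R.genideal_minimal[OF toric S])
  ultimately show ?thesis by blast
qed

end
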